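(* Let $F$, $f$, $(\xi_k)_{k\in\mathbb N}$, $G$, $H$, $(\alpha_k)_{k\in\mathbb N}$ and $(w_k)_{k\in\mathbb N}$ be as in the context, and suppose that (A1), (A2), (A3) hold and that there is $w_*\in\arg\min_{w\in\mathbb R^d}F(w)$ which satisfies (A4) or (A5), and which satisfies (A6). Suppose that $\sum_{k=1}^\infty\alpha_k^2<\infty$ and $\sum_{k=1}^\infty\alpha_k=\infty$. For $K\in\mathbb N$ and $\omega\in\Omega$ let $$\zeta_K(\omega)=\min_{1\le k\le K}\|\nabla F(w_k(\omega))\|^2.$$ Then $\zeta_K$ converges to $0$ almost surely, i.e. $$\mathbb P\Big(\Big\{\omega\in\Omega:\ \lim_{K\to\infty}\zeta_K(\omega)=0\Big\}\Big)=1.$$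
   Context: Notation: $\|\cdot\|$ is the Euclidean norm on $\mathbb R^d$, $d\in\mathbb N$; $\mathbb N=\{1,2,\dots\}$; $\mathbb R^+$ denotes the positive reals and $\mathbb R^+_0$ the non-negative reals. $(\Omega,\mathcal F,\mathbb P)$ is a complete probability space; $(\xi_k)_{k\in\mathbb N}$ is a sequence of independent, identically distributed random variables on $\Omega$, and $\xi$ denotes a random variable with their common distribution. The objective function is $F:\mathbb R^d\to\mathbb R$, $F(w)=\mathbb E[f(w,\xi)]$. Method: given functions $G,H:\mathbb R^d\times\mathbb R^+\to\mathbb R^d$ with $G(x,\alpha)=x-\alpha H(x,\alpha)$, step sizes $\alpha_k\in\mathbb R^+$ and a (deterministic) initial value $w_1\in\mathbb R^d$, the sequence $(w_k)_{k\in\mathbb N}$ is generated by $$w_{k+1}=w_k-\alpha_kG(\nabla f(w_k,\xi_k),\alpha_k)=w_k-\alpha_k\nabla f(w_k,\xi_k)+\alpha_k^2H(\nabla f(w_k,\xi_k),\alpha_k).$$ Assumptions: (A1) There are constants $c_g\in\mathbb R^+$ and $c_h\in\mathbb R^+_0$ such that $\|G(x,\alpha)\|\le c_g\|x\|$ and $\|H(x,\alpha)\|\le c_h\|x\|^2$ for all $x\in\mathbb R^d$, $\alpha\in\mathbb R^+$. (A2) (Unbiased gradients) The stochastic gradient $\nabla f(\cdot,\xi)$ satisfies $\mathbb E[\nabla f(v,\xi)]=\nabla F(v)$ for all $v\in\mathbb R^d$. (A3) (Lipschitz gradients) $F$ is continuously differentiable and $\|\nabla F(v)-\nabla F(w)\|\le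 L\|v-w\|$ for all $v,w\in\mathbb R^d$, with $L\in\mathbb R^+$. Moreover there is a $\sigma(\xi)$-measurable, square-integrable random variable $L_\xi$ with values in $\mathbb R^+$ such that almost surely $\|\nabla f(v,\xi)-\nabla f(w,\xi)\|\le L_\xi\|v-w\|$ for all $v,w\in\mathbb R^d$, and $\mathbb E[L_\xi^2]\le L^2$. (A4) (Bounded variance, for $w_*\in\arg\min F$) $\mathbb E[\|\nabla f(w_*,\xi)\|^2]\le\sigma^2$ for some finite $\sigma^2$. (A5) (Interpolation, for $w_*\in\arg\min F$) almost surely $w_*\in\arg\min_{w\in\mathbb R^d}f(w,\xi)$; in particular $\nabla f(w_*,\xi)=0$ almost surely. (A6) (Moment bound, for $w_*$) there is $M\in\mathbb R^+$ with $\mathbb E[\|w_k-w_*\|^3]\le M$ for every $k\in\mathbb N$. *)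

theory Defs
  imports "HOL-Probability.Probability"
begin

definition gradient :: "('a::real_inner \<Rightarrow> real) \<Rightarrow> 'a \<Rightarrow> 'a" where
  "gradient f x = (THE D. GDERIV f x :> D)"

definition objective :: "'w measure \<Rightarrow> ('a \<Rightarrow> 's \<Rightarrow> real) \<Rightarrow> ('w \<Rightarrow> 's) \<Rightarrow> 'a \<Rightarrow> real" where
  "objective M f \<xi> v = (\<integral>\<omega>. f v (\<xi> \<omega>) \<partial>M)"

abbreviation stoch_grad :: "('a::real_inner \<Rightarrow> 's \<Rightarrow> real) \<Rightarrow> 'a \<Rightarrow> 's \<Rightarrow> 'a" where
  "stoch_grad f v s \<equiv> gradient (\<lambda>u. f u s) v"

text \<open>Only used for \<open>K \<ge> 1\<close>; the minimum over the empty set at \<open>K = 0\<close> is unspecified.\<close>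

definition min_sq_grad :: "('a::real_inner \<Rightarrow> real) \<Rightarrow> (nat \<Rightarrow> 'w \<Rightarrow> 'a) \<Rightarrow> nat \<Rightarrow> 'w \<Rightarrow> real" where
  "min_sq_grad F w K \<omega> = (MIN k\<in>{1..K}. (norm (gradient F (w k \<omega>)))\<^sup>2)"

end

(* With a = a_k and the step -a q + a^2 H (q), the descent inequality gives, conditionally on w k = v,
   E F (w (k+1)) <= F v - a |grad F v|^2 + a^2 C (1 + |v - w_star|^3): the second moment of the
   stochastic gradient grows quadratically in |v - w_star|, and the term <grad F v, H (q)>
   contributes one more factor |v - w_star|. As w k is independent of the k-th sample, integrating over
   v and using the third moment bound yields
   sum_k a_k E |grad F (w k)|^2 < infinity. Hence sum_k a_k |grad F (w k)|^2 is almost surely finite,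
   and since sum_k a_k diverges the running minimum tends to 0. *)
theory Submission
  imports Defs
begin

section \<open>Gradients and the descent inequality\<close>

text \<open>\<open>gradient\<close> is a definite description, so existence and uniqueness are both
  required. In finite dimension the derivative \<open>f'\<close> is the inner product with the
  vector whose coordinates are \<open>f' b\<close>; two representing vectors agree, as one sees by
  testing with their difference.\<close>

lemma GDERIV_gradient:
  fixes f :: "'a::euclidean_space \<Rightarrow> real"
  assumes "f differentiable (at x)"
  shows "GDERIV f x :> gradient f x"
proof -
  from assms obtain f' where f': "(f has_derivative f') (at x)"
    unfolding differentiable_def by blast
  interpret bounded_linear f' using f' by (rule has_derivative_bounded_linear)
  define g where "g = (\<Sum>b\<in>Basis. f' b *\<^sub>R b)"
  have "f' = (\<lambda>h. h \<bullet> g)"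
  proof
    fix h
    have "f' h = f' (\<Sum>b\<in>Basis. (h \<bullet> b) *\<^sub>R b)"
      by (simp add: euclidean_representation)
    also have "\<dots> = (\<Sum>b\<in>Basis. (h \<bullet> b) * f' b)"
      by (simp add: sum scaleR)
    also have "\<dots> = h \<bullet> g"
      by (simp add: g_def inner_sum_right mult.commute)
    finally show "f' h = h \<bullet> g" .
  qed
  with f' have ex: "GDERIV f x :> g"
    unfolding gderiv_def by simp
  have uniq: "D = D'" if "GDERIV f x :> D" "GDERIV f x :> D'" for D D'
  proof -
    have "(\<lambda>h. h \<bullet> D) = (\<lambda>h. h \<bullet> D')"
      using that unfolding gderiv_def by (rule has_derivative_unique)
    from fun_cong[OF this, of "D - D'"] have "(D - D') \<bullet> (D - D') = 0"
      by (simp only: inner_diff_right diff_self)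
    then show ?thesis by (simp only: inner_eq_zero_iff right_minus_eq)
  qed
  show ?thesis
    unfolding gradient_def by (rule theI[of "\<lambda>D. GDERIV f x :> D", OF ex uniq[OF _ ex]])
qed

text \<open>Serves twice: for \<open>F\<close> it leads to linear growth of the gradient around the
  minimiser, and for single samples it turns interpolation into a vanishing stochastic
  gradient.\<close>

lemma gradient_arg_min_eq_0:
  fixes f :: "'a::euclidean_space \<Rightarrow> real"
  assumes "f differentiable (at x)" and "is_arg_min f (\<lambda>_. True) x"
  shows "gradient f x = 0"
proof -
  have "(\<lambda>h. h \<bullet> gradient f x) = (\<lambda>h. 0)"
    using GDERIV_gradient[OF assms(1)] assms(2)
    unfolding gderiv_def
    by (rule_tac has_derivative_local_min) (auto simp: is_arg_min_linorder)
  from fun_cong[OF this, of "gradient f x"] show ?thesis by simp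
qed

text \<open>The mean value theorem on the segment from \<open>u\<close> to \<open>u + d\<close>
  yields the gradient at an intermediate point, which differs from the gradient at \<open>u\<close>
  by at most \<open>L * norm d\<close>. This gives the constant \<open>L\<close> instead of the
  sharp \<open>L / 2\<close>; only the order of the quadratic term matters later.\<close>

lemma descent_inequality:
  fixes F :: "'a::euclidean_space \<Rightarrow> real"
  assumes diff: "\<And>v. F differentiable (at v)"
    and lip: "\<And>u v. norm (gradient F u - gradient F v) \<le> L * norm (u - v)"
  shows "F (u + d) \<le> F u + gradient F u \<bullet> d + L * (norm d)\<^sup>2"
proof -
  have der: "((\<lambda>t. F (u + t *\<^sub>R d)) has_derivative (\<lambda>t. (t *\<^sub>R d) \<bullet> gradient F (u + x *\<^sub>R d))) (at x within A)" for x A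
  proof -
    have "((\<lambda>t. u + t *\<^sub>R d) has_derivative (\<lambda>t. t *\<^sub>R d)) (at x within A)"
      by (auto intro!: derivative_eq_intros)
    then show ?thesis
      using GDERIV_gradient[OF diff, of "u + x *\<^sub>R d"] unfolding gderiv_def
      by (rule has_derivative_compose)
  qed
  obtain t where t: "0 < t" "t < 1" and eq: "F (u + d) - F u = d \<bullet> gradient F (u + t *\<^sub>R d)"
    using mvt_simple[of 0 1 "\<lambda>t. F (u + t *\<^sub>R d)", OF _ der] by auto
  \<comment> \<open>The sign of \<open>L\<close> is read off from the Lipschitz bound at two
    distinct points. It is needed to replace \<open>t\<close> by 1 below; for \<open>d = 0\<close>
    both sides there vanish.\<close>
  have "L \<ge> 0" if "d \<noteq> 0"
  proof -
    have "0 \<le> L * norm d"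
      using order_trans[OF norm_ge_zero lip[of "u + d" u]] by simp
    then show ?thesis using that by (simp add: zero_le_mult_iff)
  qed
  have "d \<bullet> (gradient F (u + t *\<^sub>R d) - gradient F u) \<le> norm d * (L * norm (t *\<^sub>R d))"
    using norm_cauchy_schwarz[of d] lip[of "u + t *\<^sub>R d" u]
    by (smt (verit) add_diff_cancel_left' mult_left_mono norm_ge_zero)
  also have "\<dots> = t * (L * (norm d)\<^sup>2)"
    using t by (simp add: power2_eq_square)
  also have "\<dots> \<le> 1 * (L * (norm d)\<^sup>2)"
    using t \<open>d \<noteq> 0 \<Longrightarrow> L \<ge> 0\<close> by (cases "d = 0") (auto intro: mult_right_mono[of t 1, simplified])
  finally show ?thesis
    using eq by (simp add: inner_diff_right inner_commute)
qed

section \<open>Joint measurability in the point and the sample\<close>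

text \<open>The identity on the Euclidean space is a pointwise limit of simple functions
  \<open>r i\<close>. With \<open>r i (g x)\<close> in place of \<open>g x\<close> the first
  argument takes finitely many values, so measurability in the second suffices; continuity in the
  first then passes to the limit.\<close>

lemma borel_measurable_Caratheodory:
  fixes f :: "'a::euclidean_space \<Rightarrow> 's \<Rightarrow> real"
  assumes meas: "\<And>v. f v \<in> borel_measurable S"
    and cont: "\<And>s v. s \<in> space S \<Longrightarrow> isCont (\<lambda>u. f u s) v"
    and g [measurable]: "g \<in> borel_measurable N" and h [measurable]: "h \<in> N \<rightarrow>\<^sub>M S"
  shows "(\<lambda>x. f (g x) (h x)) \<in> borel_measurable N"
proof -
  obtain r where r: "\<And>i. simple_function borel (r i)" and lim: "\<And>v::'a. (\<lambda>i. r i v) \<longlonglongrightarrow> v"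
    using borel_measurable_implies_sequence_metric[of "\<lambda>v::'a. v" borel 0] by auto
  have "(\<lambda>x. f (r i (g x)) (h x)) \<in> borel_measurable N" for i
  proof (rule measurable_compose_countable'[where I = "range (r i)"])
    show "countable (range (r i))"
      using simple_functionD(1)[OF r] by (simp add: countable_finite)
    have "r i \<in> borel \<rightarrow>\<^sub>M count_space (range (r i))"
      using simple_functionD[OF r[of i]] by (auto simp: measurable_count_space_eq2)
    then show "(\<lambda>x. r i (g x)) \<in> N \<rightarrow>\<^sub>M count_space (range (r i))"
      by measurable
  qed (use meas in measurable)
  then show ?thesis
    by (rule borel_measurable_LIMSEQ_real[rotated])
      (auto intro!: isCont_tendsto_compose[OF cont lim] measurable_space[OF h])
qed

text \<open>Each coordinate of the gradient is the limit of difference quotients with increments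
  \<open>1 / (n + 1)\<close>. Every quotient is measurable by the preceding lemma, since
  differentiability implies continuity, and a sequential limit keeps measurability.\<close>

lemma borel_measurable_stoch_grad:
  fixes f :: "'a::euclidean_space \<Rightarrow> 's \<Rightarrow> real"
  assumes meas: "\<And>v. f v \<in> borel_measurable S"
    and diff: "\<And>s v. s \<in> space S \<Longrightarrow> (\<lambda>u. f u s) differentiable (at v)"
    and g [measurable]: "g \<in> borel_measurable N" and h [measurable]: "h \<in> N \<rightarrow>\<^sub>M S"
  shows "(\<lambda>x. stoch_grad f (g x) (h x)) \<in> borel_measurable N"
proof (rule borel_measurable_euclidean_space[THEN iffD2], rule ballI)
  fix b :: 'a assume "b \<in> Basis"
  have cont: "isCont (\<lambda>u. f u s) v" if "s \<in> space S" for s v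
    using diff[OF that] by (rule differentiable_imp_continuous_within)
  have meas_f: "(\<lambda>x. f (g' x) (h x)) \<in> borel_measurable N" if "g' \<in> borel_measurable N" for g'
    by (rule borel_measurable_Caratheodory[OF meas cont that h])
  have "(\<lambda>n. (f (v + inverse (real (Suc n)) *\<^sub>R b) s - f v s) / inverse (real (Suc n)))
      \<longlonglongrightarrow> stoch_grad f v s \<bullet> b" if "s \<in> space S" for v s
  proof -
    have "((\<lambda>t. v + t *\<^sub>R b) has_derivative (\<lambda>t. t *\<^sub>R b)) (at 0)"
      by (auto intro!: derivative_eq_intros)
    then have "((\<lambda>t. f (v + t *\<^sub>R b) s) has_derivative (\<lambda>t. (t *\<^sub>R b) \<bullet> stoch_grad f v s)) (at 0)"
      by (rule has_derivative_compose)
        (use GDERIV_gradient[OF diff[OF that, of v]] in \<open>simp add: gderiv_def\<close>)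
    then have "((\<lambda>t. f (v + t *\<^sub>R b) s) has_field_derivative stoch_grad f v s \<bullet> b) (at 0)"
      unfolding has_field_derivative_def
      by (rule has_derivative_eq_rhs) (simp add: fun_eq_iff inner_commute mult.commute)
    then have "((\<lambda>h. (f (v + h *\<^sub>R b) s - f v s) / h) \<longlongrightarrow> stoch_grad f v s \<bullet> b) (at 0)"
      by (simp add: DERIV_def)
    moreover have "filterlim (\<lambda>n. inverse (real (Suc n))) (at 0) sequentially"
      using LIMSEQ_inverse_real_of_nat by (auto simp: filterlim_at intro!: always_eventually)
    ultimately show ?thesis by (rule filterlim_compose)
  qed
  note lim = this
  show "(\<lambda>x. stoch_grad f (g x) (h x) \<bullet> b) \<in> borel_measurable N"
  proof (rule borel_measurable_LIMSEQ_real)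
    show "(\<lambda>n. (f (g x + inverse (real (Suc n)) *\<^sub>R b) (h x) - f (g x) (h x)) / inverse (real (Suc n)))
      \<longlonglongrightarrow> stoch_grad f (g x) (h x) \<bullet> b" if "x \<in> space N" for x
      by (rule lim) (rule measurable_space[OF h that])
    show "(\<lambda>x. (f (g x + inverse (real (Suc n)) *\<^sub>R b) (h x) - f (g x) (h x)) / inverse (real (Suc n)))
      \<in> borel_measurable N" for n
      by (intro borel_measurable_divide borel_measurable_diff meas_f) measurable
  qed
qed

section \<open>Running minima under divergent weights\<close>

text \<open>The minimum times the total weight is at most the weighted sum, hence at most
  \<open>C\<close>; dividing by the divergent total weight squeezes the minimum to 0.\<close>

lemma Min_weighted_sum_tendsto_0:
  fixes a x :: "nat \<Rightarrow> real"
  assumes a: "\<And>k. k \<ge> 1 \<Longrightarrow> a k > 0" and x: "\<And>k. k \<ge> 1 \<Longrightarrow> x k \<ge> 0"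
    and bound: "\<And>n. (\<Sum>k=1..n. a k * x k) \<le> C"
    and div: "filterlim (\<lambda>n. \<Sum>k=1..n. a k) at_top sequentially"
  shows "(\<lambda>K. MIN k\<in>{1..K}. x k) \<longlonglongrightarrow> 0"
proof (rule tendsto_sandwich[OF _ _ tendsto_const])
  show "(\<lambda>K. C / (\<Sum>k=1..K. a k)) \<longlonglongrightarrow> 0"
    using div by (intro tendsto_divide_0[OF tendsto_const] filterlim_at_top_imp_at_infinity)
  \<comment> \<open>Both bounds are claimed from \<open>K = 1\<close> on, because the minimum over
    the empty set is unspecified.\<close>
  show "eventually (\<lambda>K. 0 \<le> (MIN k\<in>{1..K}. x k)) sequentially"
    using eventually_ge_at_top[of 1] by eventually_elim (auto intro!: Min.boundedI x)
  show "eventually (\<lambda>K. (MIN k\<in>{1..K}. x k) \<le> C / (\<Sum>k=1..K. a k)) sequentially"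
    using eventually_ge_at_top[of 1]
  proof eventually_elim
    case (elim K)
    have "(\<Sum>k=1..K. a k) * (MIN k\<in>{1..K}. x k) \<le> (\<Sum>k=1..K. a k * x k)"
      unfolding sum_distrib_right
      by (intro sum_mono mult_left_mono Min_le) (auto intro: less_imp_le[OF a])
    also have "\<dots> \<le> C" by (rule bound)
    finally show ?case
      using elim a by (subst pos_le_divide_eq) (auto intro!: sum_pos simp: mult.commute)
  qed
qed

section \<open>Independence of the iterate and the current sample\<close>

text \<open>By independence the joint law is a product measure, so Tonelli applies, and the inner
  integral depends on \<open>Y\<close> only through its law. The inner integral with
  \<open>X \<omega>\<close> held fixed takes the place of a conditional expectation given
  \<open>X\<close>.\<close>

lemma (in prob_space) nn_integral_indep_copy:
  assumes indep: "indep_var N X S Y" and Z [measurable]: "Z \<in> M \<rightarrow>\<^sub>M S"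
    and YZ: "distr M S Y = distr M S Z"
    and h [measurable]: "h \<in> borel_measurable (N \<Otimes>\<^sub>M S)"
  shows "(\<integral>\<^sup>+\<omega>. h (X \<omega>, Y \<omega>) \<partial>M) = (\<integral>\<^sup>+\<omega>. \<integral>\<^sup>+\<omega>'. h (X \<omega>, Z \<omega>') \<partial>M \<partial>M)"
proof -
  from indep have [measurable]: "X \<in> M \<rightarrow>\<^sub>M N" "Y \<in> M \<rightarrow>\<^sub>M S"
    and prod: "distr M N X \<Otimes>\<^sub>M distr M S Y = distr M (N \<Otimes>\<^sub>M S) (\<lambda>\<omega>. (X \<omega>, Y \<omega>))"
    unfolding indep_var_distribution_eq by auto
  interpret D: prob_space "distr M S Z" by (rule prob_space_distr) simp
  \<comment> \<open>Measurability of the inner integral is obtained for the product with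
    \<open>distr M S Z\<close>, which has the same measurable sets as \<open>S\<close>.\<close>
  have h': "h \<in> borel_measurable (N \<Otimes>\<^sub>M distr M S Z)"
    by (subst measurable_cong_sets[OF sets_pair_measure_cong[OF refl sets_distr] refl]) (rule h)
  have "(\<integral>\<^sup>+\<omega>. h (X \<omega>, Y \<omega>) \<partial>M) = integral\<^sup>N (distr M N X \<Otimes>\<^sub>M distr M S Z) h"
    unfolding YZ[symmetric] prod by (subst nn_integral_distr) auto
  also have "\<dots> = (\<integral>\<^sup>+x. \<integral>\<^sup>+y. h (x, y) \<partial>distr M S Z \<partial>distr M N X)"
    by (subst D.nn_integral_fst[symmetric]) auto
  also have "\<dots> = (\<integral>\<^sup>+\<omega>. \<integral>\<^sup>+y. h (X \<omega>, y) \<partial>distr M S Z \<partial>M)"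
    using D.borel_measurable_nn_integral_fst[OF h'] by (subst nn_integral_distr) auto
  also have "\<dots> = (\<integral>\<^sup>+\<omega>. \<integral>\<^sup>+\<omega>'. h (X \<omega>, Z \<omega>') \<partial>M \<partial>M)"
    by (intro nn_integral_cong nn_integral_distr) (auto intro!: measurable_Pair2[OF h] measurable_space[of X])
  finally show ?thesis .
qed

text \<open>Unrolling the recursion shows that \<open>w k\<close> is a measurable function
  \<open>V\<close> of the samples with indices \<open>1..<k\<close>. It is therefore a random
  variable independent of \<open>Y k\<close>, and the preceding lemma applies.\<close>

lemma (in prob_space) nn_integral_indep_recursion:
  fixes w :: "nat \<Rightarrow> 'a \<Rightarrow> 'b" and Y :: "nat \<Rightarrow> 'a \<Rightarrow> 's"
  assumes indep: "indep_vars (\<lambda>_. S) Y {1..}"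
    and init: "\<And>\<omega>. \<omega> \<in> space M \<Longrightarrow> w 1 \<omega> = x" and x: "x \<in> space N"
    and step: "\<And>k \<omega>. k \<ge> 1 \<Longrightarrow> \<omega> \<in> space M \<Longrightarrow> w (k + 1) \<omega> = T k (w k \<omega>, Y k \<omega>)"
    and T [measurable]: "\<And>k. k \<ge> 1 \<Longrightarrow> T k \<in> N \<Otimes>\<^sub>M S \<rightarrow>\<^sub>M N"
    and k: "k \<ge> 1"
  shows "w k \<in> M \<rightarrow>\<^sub>M N"
    and "\<lbrakk>Z \<in> M \<rightarrow>\<^sub>M S; distr M S (Y k) = distr M S Z; h \<in> borel_measurable (N \<Otimes>\<^sub>M S)\<rbrakk>
      \<Longrightarrow> (\<integral>\<^sup>+\<omega>. h (w k \<omega>, Y k \<omega>) \<partial>M) = (\<integral>\<^sup>+\<omega>. \<integral>\<^sup>+\<omega>'. h (w k \<omega>, Z \<omega>') \<partial>M \<partial>M)"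
proof -
  have "\<exists>V \<in> PiM {1..<k} (\<lambda>_. S) \<rightarrow>\<^sub>M N. \<forall>\<omega>\<in>space M. w k \<omega> = V (\<lambda>i\<in>{1..<k}. Y i \<omega>)"
    using k
  proof (induction k rule: dec_induct)
    case base
    \<comment> \<open>For \<open>k = 1\<close> the index set \<open>{1..<1}\<close> is empty and
      \<open>V\<close> is the constant initial value.\<close>
    show ?case
      by (rule bexI[of _ "\<lambda>_. x"]) (use init measurable_const[OF x] in blast)+
  next
    case (step n)
    from step.IH obtain V where V [measurable]: "V \<in> PiM {1..<n} (\<lambda>_. S) \<rightarrow>\<^sub>M N"
      and eq: "\<And>\<omega>. \<omega> \<in> space M \<Longrightarrow> w n \<omega> = V (\<lambda>i\<in>{1..<n}. Y i \<omega>)" by blast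
    have [measurable]: "(\<lambda>y. restrict y {1..<n}) \<in> PiM {1..<Suc n} (\<lambda>_. S) \<rightarrow>\<^sub>M PiM {1..<n} (\<lambda>_. S)"
      by (rule measurable_restrict_subset) auto
    have [measurable]: "(\<lambda>y. y n) \<in> PiM {1..<Suc n} (\<lambda>_. S) \<rightarrow>\<^sub>M S"
      using step.hyps by (intro measurable_component_singleton) auto
    note [measurable] = T[OF step.hyps(1)]
    have "(\<lambda>y. T n (V (restrict y {1..<n}), y n)) \<in> PiM {1..<Suc n} (\<lambda>_. S) \<rightarrow>\<^sub>M N"
      by measurable
    moreover have "w (Suc n) \<omega> = T n (V (restrict (\<lambda>i\<in>{1..<Suc n}. Y i \<omega>) {1..<n}), (\<lambda>i\<in>{1..<Suc n}. Y i \<omega>) n)"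
      if "\<omega> \<in> space M" for \<omega>
    proof -
      have "restrict (\<lambda>i\<in>{1..<Suc n}. Y i \<omega>) {1..<n} = (\<lambda>i\<in>{1..<n}. Y i \<omega>)"
        by (auto simp: fun_eq_iff)
      then show ?thesis
        using step.hyps assms(4)[of n \<omega>] eq[OF that] that by simp
    qed
    ultimately show ?case by (intro bexI ballI)
  qed
  then obtain V where V: "V \<in> PiM {1..<k} (\<lambda>_. S) \<rightarrow>\<^sub>M N"
    and eq: "\<And>\<omega>. \<omega> \<in> space M \<Longrightarrow> w k \<omega> = V (\<lambda>i\<in>{1..<k}. Y i \<omega>)" by blast
  let ?P = "PiM {1..<k} (\<lambda>_. S)" and ?Q = "PiM {k} (\<lambda>_. S)"
  let ?past = "\<lambda>\<omega>. \<lambda>i\<in>{1..<k}. Y i \<omega>"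
  have past_indep: "indep_var ?P ?past ?Q (\<lambda>\<omega>. \<lambda>i\<in>{k}. Y i \<omega>)"
    by (rule indep_var_restrict[OF indep]) (use k in auto)
  from measurable_compose[OF indep_var_rv1[OF this] V] show "w k \<in> M \<rightarrow>\<^sub>M N"
    by (subst measurable_cong[where g = "\<lambda>\<omega>. V (?past \<omega>)"]) (simp_all add: eq)
  assume Z [measurable]: "Z \<in> M \<rightarrow>\<^sub>M S" and YZ: "distr M S (Y k) = distr M S Z"
    and h [measurable]: "h \<in> borel_measurable (N \<Otimes>\<^sub>M S)"
  have Y [measurable]: "Y k \<in> M \<rightarrow>\<^sub>M S"
    using indep k unfolding indep_vars_def by auto
  \<comment> \<open>Independence of disjoint blocks speaks of restricted families, so the current
    sample appears as a function on \<open>{k}\<close>. This embedding carries the equality of laws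
    to that form, and \<open>proj\<close> undoes it.\<close>
  have emb [measurable]: "(\<lambda>y. \<lambda>i\<in>{k}. y) \<in> S \<rightarrow>\<^sub>M ?Q"
    by (rule measurable_restrict) simp
  have "distr M ?Q (\<lambda>\<omega>. \<lambda>i\<in>{k}. Y i \<omega>) = distr (distr M S (Y k)) ?Q (\<lambda>y. \<lambda>i\<in>{k}. y)"
    by (subst distr_distr) (auto intro!: distr_cong simp: fun_eq_iff)
  also have "\<dots> = distr M ?Q (\<lambda>\<omega>. \<lambda>i\<in>{k}. Z \<omega>)"
    unfolding YZ by (subst distr_distr) (auto intro!: distr_cong)
  finally have YZ': "distr M ?Q (\<lambda>\<omega>. \<lambda>i\<in>{k}. Y i \<omega>) = distr M ?Q (\<lambda>\<omega>. \<lambda>i\<in>{k}. Z \<omega>)" .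
  have Z': "(\<lambda>\<omega>. \<lambda>i\<in>{k}. Z \<omega>) \<in> M \<rightarrow>\<^sub>M ?Q"
    by (rule measurable_compose[OF Z emb])
  have proj [measurable]: "(\<lambda>y. y k) \<in> ?Q \<rightarrow>\<^sub>M S"
    by (rule measurable_component_singleton) simp
  note [measurable] = V
  have "(\<lambda>p. h (V (fst p), snd p k)) \<in> borel_measurable (?P \<Otimes>\<^sub>M ?Q)"
    by measurable
  from nn_integral_indep_copy[OF past_indep Z' YZ' this]
  have "(\<integral>\<^sup>+\<omega>. h (V (?past \<omega>), Y k \<omega>) \<partial>M) = (\<integral>\<^sup>+\<omega>. \<integral>\<^sup>+\<omega>'. h (V (?past \<omega>), Z \<omega>') \<partial>M \<partial>M)"
    by simp
  then show "(\<integral>\<^sup>+\<omega>. h (w k \<omega>, Y k \<omega>) \<partial>M) = (\<integral>\<^sup>+\<omega>. \<integral>\<^sup>+\<omega>'. h (w k \<omega>, Z \<omega>') \<partial>M \<partial>M)"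
    by (simp add: eq cong: nn_integral_cong_simp)
qed

section \<open>Moment estimates for a single step\<close>

text \<open>Comparison with the reference point \<open>v\<^sub>0\<close> by the random Lipschitz
  constant, then \<open>(a + b)^2 <= 2 a^2 + 2 b^2\<close> and integration.\<close>

lemma second_moment_bound:
  fixes X :: "'b::real_normed_vector \<Rightarrow> 'w \<Rightarrow> 'a::euclidean_space"
  assumes X [measurable]: "\<And>v. X v \<in> borel_measurable M"
    and lip: "AE \<omega> in M. \<forall>u v. norm (X u \<omega> - X v \<omega>) \<le> l \<omega> * norm (u - v)"
    and l: "integrable M (\<lambda>\<omega>. (l \<omega>)\<^sup>2)" "(\<integral>\<omega>. (l \<omega>)\<^sup>2 \<partial>M) \<le> L\<^sup>2"
    and X0: "integrable M (\<lambda>\<omega>. (norm (X v\<^sub>0 \<omega>))\<^sup>2)" "(\<integral>\<omega>. (norm (X v\<^sub>0 \<omega>))\<^sup>2 \<partial>M) \<le> s\<^sup>2"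
  shows "integrable M (\<lambda>\<omega>. (norm (X v \<omega>))\<^sup>2)"
    and "(\<integral>\<omega>. (norm (X v \<omega>))\<^sup>2 \<partial>M) \<le> 2 * L\<^sup>2 * (norm (v - v\<^sub>0))\<^sup>2 + 2 * s\<^sup>2"
proof -
  let ?R = "\<lambda>\<omega>. 2 * (norm (v - v\<^sub>0))\<^sup>2 * (l \<omega>)\<^sup>2 + 2 * (norm (X v\<^sub>0 \<omega>))\<^sup>2"
  have R: "integrable M ?R"
    using l X0 by (intro Bochner_Integration.integrable_add integrable_mult_right)
  have le: "AE \<omega> in M. (norm (X v \<omega>))\<^sup>2 \<le> ?R \<omega>"
    using lip
  proof eventually_elim
    case (elim \<omega>)
    have "norm (X v \<omega>) \<le> norm (X v \<omega> - X v\<^sub>0 \<omega>) + norm (X v\<^sub>0 \<omega>)"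
      using norm_triangle_ineq[of "X v \<omega> - X v\<^sub>0 \<omega>" "X v\<^sub>0 \<omega>"] by simp
    also have "\<dots> \<le> l \<omega> * norm (v - v\<^sub>0) + norm (X v\<^sub>0 \<omega>)"
      using elim by simp
    finally have "(norm (X v \<omega>))\<^sup>2 \<le> (l \<omega> * norm (v - v\<^sub>0) + norm (X v\<^sub>0 \<omega>))\<^sup>2"
      by (rule power_mono) simp
    also have "\<dots> \<le> 2 * (l \<omega> * norm (v - v\<^sub>0))\<^sup>2 + 2 * (norm (X v\<^sub>0 \<omega>))\<^sup>2"
      using sum_squares_bound[of "l \<omega> * norm (v - v\<^sub>0)" "norm (X v\<^sub>0 \<omega>)"] by (simp add: power2_sum)
    finally show ?case by (simp add: power_mult_distrib algebra_simps)
  qed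
  show int: "integrable M (\<lambda>\<omega>. (norm (X v \<omega>))\<^sup>2)"
    by (rule Bochner_Integration.integrable_bound[OF R]) (use le in auto)
  have "(\<integral>\<omega>. (norm (X v \<omega>))\<^sup>2 \<partial>M) \<le> (\<integral>\<omega>. ?R \<omega> \<partial>M)"
    by (rule integral_mono_AE[OF int R le])
  also have "\<dots> = 2 * (norm (v - v\<^sub>0))\<^sup>2 * (\<integral>\<omega>. (l \<omega>)\<^sup>2 \<partial>M) + 2 * (\<integral>\<omega>. (norm (X v\<^sub>0 \<omega>))\<^sup>2 \<partial>M)"
    using l X0 by simp
  also have "\<dots> \<le> 2 * (norm (v - v\<^sub>0))\<^sup>2 * L\<^sup>2 + 2 * s\<^sup>2"
    using l X0 by (intro add_mono mult_left_mono) auto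
  finally show "(\<integral>\<omega>. (norm (X v \<omega>))\<^sup>2 \<partial>M) \<le> 2 * L\<^sup>2 * (norm (v - v\<^sub>0))\<^sup>2 + 2 * s\<^sup>2"
    by (simp add: algebra_simps)
qed

text \<open>The first-order part of the descent inequality averages to
  \<open>- a |grad F v|^2\<close> by unbiasedness; the \<open>H\<close> part and the squared step
  together cost at most \<open>a^2 V\<close>. Subtracting the lower bound \<open>m\<close> makes all
  quantities nonnegative, and the decrease stands on the left because subtraction in
  \<open>ennreal\<close> is truncated.\<close>

lemma (in prob_space) expected_descent:
  fixes F :: "'b::euclidean_space \<Rightarrow> real"
  assumes diff: "\<And>v. F differentiable (at v)"
    and lip: "\<And>u v. norm (gradient F u - gradient F v) \<le> L * norm (u - v)"
    and lower: "\<And>u. m \<le> F u"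
    and q: "has_bochner_integral M q (gradient F v)"
    and q2: "integrable M (\<lambda>\<omega>. (norm (q \<omega>))\<^sup>2)"
    and GH: "\<And>x. G x = x - a *\<^sub>R H x"
    and G: "\<And>x. norm (G x) \<le> c\<^sub>g * norm x" and H: "\<And>x. norm (H x) \<le> c\<^sub>h * (norm x)\<^sup>2"
    and "a > 0" "L > 0" "c\<^sub>h \<ge> 0"
    and V: "(c\<^sub>h * norm (gradient F v) + L * c\<^sub>g\<^sup>2) * (\<integral>\<omega>. (norm (q \<omega>))\<^sup>2 \<partial>M) \<le> V"
  shows "(\<integral>\<^sup>+\<omega>. ennreal (F (v - a *\<^sub>R G (q \<omega>)) - m) \<partial>M) + ennreal (a * (norm (gradient F v))\<^sup>2)
    \<le> ennreal (F v - m) + ennreal (a\<^sup>2 * V)"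
proof -
  let ?g = "gradient F v"
  let ?c = "c\<^sub>h * norm ?g + L * c\<^sub>g\<^sup>2"
  let ?R = "\<lambda>\<omega>. (F v - m) - a * (?g \<bullet> q \<omega>) + a\<^sup>2 * (?c * (norm (q \<omega>))\<^sup>2)"
  have c: "?c \<ge> 0" using assms by simp
  have le: "F (v - a *\<^sub>R G (q \<omega>)) - m \<le> ?R \<omega>" for \<omega>
  proof -
    have "F (v - a *\<^sub>R G (q \<omega>)) \<le> F v + ?g \<bullet> (- a *\<^sub>R G (q \<omega>)) + L * (norm (- a *\<^sub>R G (q \<omega>)))\<^sup>2"
      using descent_inequality[OF diff lip, of v "- a *\<^sub>R G (q \<omega>)"] by simp
    \<comment> \<open>Splitting \<open>G\<close> into \<open>q\<close> and \<open>H\<close> keeps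
      the term linear in \<open>q\<close> exact, since its mean is known; only the \<open>H\<close>
      term is estimated.\<close>
    moreover have "?g \<bullet> (- a *\<^sub>R G (q \<omega>)) \<le> - a * (?g \<bullet> q \<omega>) + a\<^sup>2 * (c\<^sub>h * norm ?g * (norm (q \<omega>))\<^sup>2)"
    proof -
      have "?g \<bullet> H (q \<omega>) \<le> norm ?g * norm (H (q \<omega>))"
        by (rule norm_cauchy_schwarz)
      also have "\<dots> \<le> norm ?g * (c\<^sub>h * (norm (q \<omega>))\<^sup>2)"
        by (intro mult_left_mono H) simp
      finally have "a\<^sup>2 * (?g \<bullet> H (q \<omega>)) \<le> a\<^sup>2 * (norm ?g * (c\<^sub>h * (norm (q \<omega>))\<^sup>2))"
        by (intro mult_left_mono) auto
      then show ?thesis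
        by (simp add: GH inner_diff_right power2_eq_square algebra_simps)
    qed
    moreover have "L * (norm (- a *\<^sub>R G (q \<omega>)))\<^sup>2 \<le> a\<^sup>2 * (L * c\<^sub>g\<^sup>2 * (norm (q \<omega>))\<^sup>2)"
    proof -
      have "(norm (G (q \<omega>)))\<^sup>2 \<le> (c\<^sub>g * norm (q \<omega>))\<^sup>2"
        by (intro power_mono G) simp
      then have "a\<^sup>2 * L * (norm (G (q \<omega>)))\<^sup>2 \<le> a\<^sup>2 * L * (c\<^sub>g * norm (q \<omega>))\<^sup>2"
        using \<open>L > 0\<close> by (intro mult_left_mono) auto
      then show ?thesis by (simp add: power_mult_distrib algebra_simps)
    qed
    ultimately show ?thesis by (simp add: algebra_simps)
  qed
  have int_q: "integrable M q" "(\<integral>\<omega>. q \<omega> \<partial>M) = ?g"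
    using q by (auto simp: has_bochner_integral_iff)
  have R: "integrable M ?R"
    using int_q q2 by simp
  have R_eq: "(\<integral>\<omega>. ?R \<omega> \<partial>M) = (F v - m) - a * (norm ?g)\<^sup>2 + a\<^sup>2 * (?c * (\<integral>\<omega>. (norm (q \<omega>))\<^sup>2 \<partial>M))"
    using int_q q2 by (simp add: prob_space power2_norm_eq_inner)
  \<comment> \<open>\<open>?R\<close> has a term of unknown sign, but it dominates a nonnegative
    quantity; this permits computing its \<open>ennreal\<close> integral as a Bochner
    integral.\<close>
  have pos: "0 \<le> ?R \<omega>" for \<omega>
    using le[of \<omega>] lower[of "v - a *\<^sub>R G (q \<omega>)"] by linarith
  have V0: "0 \<le> V"
    using c by (intro order_trans[OF _ V] mult_nonneg_nonneg) auto
  have "(\<integral>\<^sup>+\<omega>. ennreal (F (v - a *\<^sub>R G (q \<omega>)) - m) \<partial>M) \<le> (\<integral>\<^sup>+\<omega>. ennreal (?R \<omega>) \<partial>M)"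
    by (intro nn_integral_mono ennreal_leI le)
  also have "\<dots> = ennreal (\<integral>\<omega>. ?R \<omega> \<partial>M)"
    by (rule nn_integral_eq_integral[OF R]) (simp add: pos)
  finally have "(\<integral>\<^sup>+\<omega>. ennreal (F (v - a *\<^sub>R G (q \<omega>)) - m) \<partial>M) + ennreal (a * (norm ?g)\<^sup>2)
      \<le> ennreal (\<integral>\<omega>. ?R \<omega> \<partial>M) + ennreal (a * (norm ?g)\<^sup>2)"
    by (rule add_right_mono)
  also have "\<dots> = ennreal ((\<integral>\<omega>. ?R \<omega> \<partial>M) + a * (norm ?g)\<^sup>2)"
    using \<open>a > 0\<close> pos by (intro ennreal_plus[symmetric] integral_nonneg) auto
  also have "\<dots> \<le> ennreal ((F v - m) + a\<^sup>2 * V)"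
    unfolding R_eq using mult_left_mono[OF V, of "a\<^sup>2"] by (intro ennreal_leI) simp
  also have "\<dots> = ennreal (F v - m) + ennreal (a\<^sup>2 * V)"
    using lower[of v] V0 by (intro ennreal_plus) auto
  finally show ?thesis .
qed

text \<open>After expansion all coefficients are nonnegative and every power of \<open>d\<close> has
  exponent at most 3, hence is at most \<open>1 + d ^ 3\<close>. The factors model the growth of the
  gradient and of the second moment.\<close>

lemma cubic_growth_bound:
  fixes a b d e g :: real
  assumes "a \<ge> 0" "b \<ge> 0" "d \<ge> 0" "e \<ge> 0" "g \<ge> 0"
  shows "(a * d + b) * (e * d\<^sup>2 + g) \<le> (a + b) * (e + g) * (1 + d ^ 3)"
proof -
  have le: "d ^ i \<le> 1 + d ^ 3" if "i \<le> 3" for i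
  proof (cases "d \<le> 1")
    case True
    then have "d ^ i \<le> 1" using assms by (intro power_le_one) auto
    then show ?thesis using assms by (simp add: add_increasing2)
  next
    case False
    then have "d ^ i \<le> d ^ 3" using that by (intro power_increasing) auto
    then show ?thesis by simp
  qed
  have "(a * d + b) * (e * d\<^sup>2 + g) = (a * e) * d ^ 3 + (a * g) * d ^ 1 + (b * e) * d ^ 2 + (b * g) * d ^ 0"
    by (simp add: algebra_simps power2_eq_square power3_eq_cube)
  also have "\<dots> \<le> (a * e) * (1 + d ^ 3) + (a * g) * (1 + d ^ 3) + (b * e) * (1 + d ^ 3) + (b * g) * (1 + d ^ 3)"
    using assms by (intro add_mono mult_left_mono le) auto
  finally show ?thesis by (simp add: algebra_simps)
qed

section \<open>Descent along the iteration and almost sure convergence\<close>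

theorem corollary7:
  fixes M :: "'w measure" and S :: "'s measure"
    and \<xi> :: "'w \<Rightarrow> 's" and \<xi>s :: "nat \<Rightarrow> 'w \<Rightarrow> 's"
    and f :: "real ^ 'd \<Rightarrow> 's \<Rightarrow> real" and F :: "real ^ 'd \<Rightarrow> real"
    and G H :: "real ^ 'd \<Rightarrow> real \<Rightarrow> real ^ 'd"
    and \<alpha> :: "nat \<Rightarrow> real" and w :: "nat \<Rightarrow> 'w \<Rightarrow> real ^ 'd" and w1 w_star :: "real ^ 'd"
    and c_g c_h L :: real and L_xi :: "'w \<Rightarrow> real"
  assumes prob: "prob_space M" and complete: "complete_measure M"
    and xi_rv: "\<xi> \<in> measurable M S"
    and xis_indep: "prob_space.indep_vars M (\<lambda>_. S) \<xi>s {1..}"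
    and xis_distr: "\<And>k. k \<ge> 1 \<Longrightarrow> distr M S (\<xi>s k) = distr M S \<xi>"
    and f_meas: "\<And>v. f v \<in> borel_measurable S"
    and f_integrable: "\<And>v. integrable M (\<lambda>\<omega>. f v (\<xi> \<omega>))"
    and f_diff: "\<And>s v. s \<in> space S \<Longrightarrow> (\<lambda>u. f u s) differentiable (at v)"
    and F_def: "F = objective M f \<xi>"
    and G_meas: "\<And>a. a > 0 \<Longrightarrow> (\<lambda>x. G x a) \<in> borel_measurable borel"
    and G_H: "\<And>x a. a > 0 \<Longrightarrow> G x a = x - a *\<^sub>R H x a"
    and alpha_pos: "\<And>k. k \<ge> 1 \<Longrightarrow> \<alpha> k > 0"
    and w_init: "\<And>\<omega>. \<omega> \<in> space M \<Longrightarrow> w 1 \<omega> = w1"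
    and w_step: "\<And>k \<omega>. k \<ge> 1 \<Longrightarrow> \<omega> \<in> space M \<Longrightarrow>
      w (k + 1) \<omega> = w k \<omega> - \<alpha> k *\<^sub>R G (stoch_grad f (w k \<omega>) (\<xi>s k \<omega>)) (\<alpha> k)"
    and c_g_pos: "c_g > 0" and c_h_nonneg: "c_h \<ge> 0"
    and G_bound: "\<And>x a. a > 0 \<Longrightarrow> norm (G x a) \<le> c_g * norm x"
    and H_bound: "\<And>x a. a > 0 \<Longrightarrow> norm (H x a) \<le> c_h * (norm x)\<^sup>2"
    and unbiased: "\<And>v. has_bochner_integral M (\<lambda>\<omega>. stoch_grad f v (\<xi> \<omega>)) (gradient F v)"
    and F_diff: "\<And>v. F differentiable (at v)"
    and F_C1: "continuous_on UNIV (gradient F)"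
    and L_pos: "L > 0"
    and F_lipschitz: "\<And>u v. norm (gradient F u - gradient F v) \<le> L * norm (u - v)"
    and L_xi_meas: "L_xi \<in> borel_measurable (vimage_algebra (space M) \<xi> S)"
    and L_xi_pos: "\<And>\<omega>. \<omega> \<in> space M \<Longrightarrow> L_xi \<omega> > 0"
    and L_xi_square_integrable: "integrable M (\<lambda>\<omega>. (L_xi \<omega>)\<^sup>2)"
    and f_lipschitz: "AE \<omega> in M. \<forall>u v.
      norm (stoch_grad f u (\<xi> \<omega>) - stoch_grad f v (\<xi> \<omega>)) \<le> L_xi \<omega> * norm (u - v)"
    and L_xi_bound: "(\<integral>\<omega>. (L_xi \<omega>)\<^sup>2 \<partial>M) \<le> L\<^sup>2"
    and w_star_min: "is_arg_min F (\<lambda>_. True) w_star"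
    and variance_or_interpolation:
      "(\<exists>\<sigma>::real. integrable M (\<lambda>\<omega>. (norm (stoch_grad f w_star (\<xi> \<omega>)))\<^sup>2) \<and>
          (\<integral>\<omega>. (norm (stoch_grad f w_star (\<xi> \<omega>)))\<^sup>2 \<partial>M) \<le> \<sigma>\<^sup>2) \<or>
       (AE \<omega> in M. is_arg_min (\<lambda>v. f v (\<xi> \<omega>)) (\<lambda>_. True) w_star)"
    and moment_bound: "\<exists>B>0. \<forall>k\<ge>1. integrable M (\<lambda>\<omega>. (norm (w k \<omega> - w_star)) ^ 3) \<and>
      (\<integral>\<omega>. (norm (w k \<omega> - w_star)) ^ 3 \<partial>M) \<le> B"
    and alpha_sq_summable: "summable (\<lambda>k. (\<alpha> (k + 1))\<^sup>2)"
    and alpha_diverges: "filterlim (\<lambda>n. \<Sum>k=1..n. \<alpha> k) at_top sequentially"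
  shows "measure M {\<omega> \<in> space M. (\<lambda>K. min_sq_grad F w K \<omega>) \<longlonglongrightarrow> 0} = 1"
proof -
  interpret prob_space M by (rule prob)
  interpret complete_measure M by (rule complete)
  define X where "X v \<omega> = stoch_grad f v (\<xi> \<omega>)" for v \<omega>
  define m where "m = F w_star"
  define d where "d v = norm (v - w_star)" for v
  note [measurable] = xi_rv
  have X_measurable [measurable]: "X v \<in> borel_measurable M" for v
    unfolding X_def using f_meas f_diff by (rule borel_measurable_stoch_grad) auto
  have grad_F_measurable [measurable]: "gradient F \<in> borel_measurable borel"
    by (rule borel_measurable_continuous_onI[OF F_C1])
  have F_measurable [measurable]: "F \<in> borel_measurable borel"
    using F_diff by (intro borel_measurable_continuous_onI continuous_at_imp_continuous_on)
      (auto intro: differentiable_imp_continuous_within)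
  have lower: "m \<le> F v" for v
    using w_star_min by (auto simp: m_def is_arg_min_linorder)
  have "gradient F w_star = 0"
    by (rule gradient_arg_min_eq_0[OF F_diff w_star_min])
  then have grad_F_le: "norm (gradient F v) \<le> L * d v" for v
    using F_lipschitz[of v w_star] by (simp add: d_def)

  \<comment> \<open>The two alternatives merge here: \<open>s\<close> is the given deviation bound,
    or 0 under interpolation.\<close>
  obtain s where X0: "integrable M (\<lambda>\<omega>. (norm (X w_star \<omega>))\<^sup>2)"
    "(\<integral>\<omega>. (norm (X w_star \<omega>))\<^sup>2 \<partial>M) \<le> s\<^sup>2"
    using variance_or_interpolation
  proof
    assume "\<exists>\<sigma>::real. integrable M (\<lambda>\<omega>. (norm (stoch_grad f w_star (\<xi> \<omega>)))\<^sup>2) \<and>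
      (\<integral>\<omega>. (norm (stoch_grad f w_star (\<xi> \<omega>)))\<^sup>2 \<partial>M) \<le> \<sigma>\<^sup>2"
    then show thesis using that by (auto simp: X_def)
  next
    assume "AE \<omega> in M. is_arg_min (\<lambda>v. f v (\<xi> \<omega>)) (\<lambda>_. True) w_star"
    then have "AE \<omega> in M. (norm (X w_star \<omega>))\<^sup>2 = 0"
      using AE_space
    proof eventually_elim
      case (elim \<omega>)
      then show ?case
        using gradient_arg_min_eq_0[OF f_diff[OF measurable_space[OF xi_rv]], of \<omega> w_star]
        by (simp add: X_def)
    qed
    then have "has_bochner_integral M (\<lambda>\<omega>. (norm (X w_star \<omega>))\<^sup>2) 0"
      by (subst has_bochner_integral_cong_AE[where g = "\<lambda>_. 0"]) (auto intro: has_bochner_integral_zero)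
    then show thesis using that[of 0] by (auto simp: has_bochner_integral_iff)
  qed
  have X_lip: "AE \<omega> in M. \<forall>u v. norm (X u \<omega> - X v \<omega>) \<le> L_xi \<omega> * norm (u - v)"
    using f_lipschitz by (simp add: X_def)
  note X_moment = second_moment_bound[OF X_measurable X_lip L_xi_square_integrable L_xi_bound X0]

  \<comment> \<open>The constant \<open>(a + b) * (e + g)\<close> of
    \<open>cubic_growth_bound\<close>, with \<open>a = c_h * L\<close> from the linear growth of the
    gradient and \<open>e\<close>, \<open>g\<close> from the second moment bound.\<close>
  define C where "C = (c_h * L + L * c_g\<^sup>2) * (2 * L\<^sup>2 + 2 * s\<^sup>2)"
  have C: "C \<ge> 0" using c_h_nonneg L_pos by (simp add: C_def)
  have descent: "(\<integral>\<^sup>+\<omega>. ennreal (F (v - a *\<^sub>R G (X v \<omega>) a) - m) \<partial>M) + ennreal (a * (norm (gradient F v))\<^sup>2)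
      \<le> ennreal (F v - m) + ennreal (a\<^sup>2 * (C * (1 + d v ^ 3)))" if "a > 0" for v a
  proof (rule expected_descent[where q = "X v" and G = "\<lambda>x. G x a" and H = "\<lambda>x. H x a",
        OF F_diff F_lipschitz lower])
    show "has_bochner_integral M (X v) (gradient F v)"
      using unbiased[of v] by (simp add: X_def[abs_def])
    have "(c_h * norm (gradient F v) + L * c_g\<^sup>2) * (\<integral>\<omega>. (norm (X v \<omega>))\<^sup>2 \<partial>M)
        \<le> (c_h * (L * d v) + L * c_g\<^sup>2) * (2 * L\<^sup>2 * (d v)\<^sup>2 + 2 * s\<^sup>2)"
      using c_h_nonneg L_pos grad_F_le[of v] X_moment(2)[of v]
      by (intro mult_mono add_mono mult_left_mono) (auto simp: d_def)
    also have "\<dots> \<le> C * (1 + d v ^ 3)"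
      using cubic_growth_bound[of "c_h * L" "L * c_g\<^sup>2" "d v" "2 * L\<^sup>2" "2 * s\<^sup>2"] c_h_nonneg L_pos
      by (simp add: C_def d_def algebra_simps)
    finally show "(c_h * norm (gradient F v) + L * c_g\<^sup>2) * (\<integral>\<omega>. (norm (X v \<omega>))\<^sup>2 \<partial>M) \<le> C * (1 + d v ^ 3)" .
  qed (use that X_moment G_H G_bound H_bound L_pos c_h_nonneg in auto)

  define T where "T k = (\<lambda>(v, s). v - \<alpha> k *\<^sub>R G (stoch_grad f v s) (\<alpha> k))" for k
  have T_measurable: "T k \<in> borel \<Otimes>\<^sub>M S \<rightarrow>\<^sub>M borel" if "k \<ge> 1" for k
  proof -
    have "(\<lambda>x. stoch_grad f (fst x) (snd x)) \<in> borel_measurable (borel \<Otimes>\<^sub>M S)"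
      using f_meas f_diff measurable_fst measurable_snd by (rule borel_measurable_stoch_grad)
    from measurable_compose[OF this G_meas[OF alpha_pos[OF that]]] show ?thesis
      unfolding T_def case_prod_beta' by measurable
  qed
  have w_init': "\<And>\<omega>. \<omega> \<in> space M \<Longrightarrow> w 1 \<omega> = w1"
    and w_step': "\<And>k \<omega>. k \<ge> 1 \<Longrightarrow> \<omega> \<in> space M \<Longrightarrow> w (k + 1) \<omega> = T k (w k \<omega>, \<xi>s k \<omega>)"
    using w_init w_step by (auto simp: T_def)
  have w1: "w1 \<in> space borel" by simp
  have w_measurable: "w k \<in> borel_measurable M" if "k \<ge> 1" for k
    by (rule nn_integral_indep_recursion(1)[OF xis_indep w_init' w1 w_step' T_measurable that])
  have indep_copy: "(\<integral>\<^sup>+\<omega>. h (w k \<omega>, \<xi>s k \<omega>) \<partial>M) = (\<integral>\<^sup>+\<omega>. \<integral>\<^sup>+\<omega>'. h (w k \<omega>, \<xi> \<omega>') \<partial>M \<partial>M)"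
    if k: "k \<ge> 1" and h: "h \<in> borel_measurable (borel \<Otimes>\<^sub>M S)" for k h
    by (rule nn_integral_indep_recursion(2)[OF xis_indep w_init' w1 w_step' T_measurable k xi_rv xis_distr[OF k] h])

  obtain B where B: "B > 0" "\<And>k. k \<ge> 1 \<Longrightarrow> integrable M (\<lambda>\<omega>. d (w k \<omega>) ^ 3)"
    "\<And>k. k \<ge> 1 \<Longrightarrow> (\<integral>\<omega>. d (w k \<omega>) ^ 3 \<partial>M) \<le> B"
    using moment_bound unfolding d_def by blast
  \<comment> \<open>With values in \<open>ennreal\<close> the expected gap makes sense before it is
    known to be finite.\<close>
  define E where "E k = (\<integral>\<^sup>+\<omega>. ennreal (F (w k \<omega>) - m) \<partial>M)" for k
  define g where "g k = (\<integral>\<^sup>+\<omega>. ennreal (\<alpha> k * (norm (gradient F (w k \<omega>)))\<^sup>2) \<partial>M)" for k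
  have E_step: "E (Suc k) + g k \<le> E k + ennreal ((\<alpha> k)\<^sup>2 * (C * (1 + B)))" if k: "k \<ge> 1" for k
  proof -
    note [measurable] = w_measurable[OF k] T_measurable[OF k]
    have "E (Suc k) = (\<integral>\<^sup>+\<omega>. ennreal (F (T k (w k \<omega>, \<xi>s k \<omega>)) - m) \<partial>M)"
      unfolding E_def using w_step[OF k] by (intro nn_integral_cong) (simp add: T_def)
    \<comment> \<open>The current sample is replaced by an independent copy, so
      \<open>descent\<close> applies inside with \<open>v = w k \<omega>\<close> fixed.\<close>
    also have "\<dots> = (\<integral>\<^sup>+\<omega>. \<integral>\<^sup>+\<omega>'. ennreal (F (T k (w k \<omega>, \<xi> \<omega>')) - m) \<partial>M \<partial>M)"
      by (rule indep_copy[OF k])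
        measurable
    finally have E_Suc: "E (Suc k) = (\<integral>\<^sup>+\<omega>. \<integral>\<^sup>+\<omega>'. ennreal (F (T k (w k \<omega>, \<xi> \<omega>')) - m) \<partial>M \<partial>M)" .
    have "E (Suc k) + g k = (\<integral>\<^sup>+\<omega>. (\<integral>\<^sup>+\<omega>'. ennreal (F (T k (w k \<omega>, \<xi> \<omega>')) - m) \<partial>M)
        + ennreal (\<alpha> k * (norm (gradient F (w k \<omega>)))\<^sup>2) \<partial>M)"
      unfolding E_Suc g_def by (rule nn_integral_add[symmetric]) measurable
    also have "\<dots> \<le> (\<integral>\<^sup>+\<omega>. ennreal (F (w k \<omega>) - m) + ennreal ((\<alpha> k)\<^sup>2 * (C * (1 + d (w k \<omega>) ^ 3))) \<partial>M)"
      using descent[OF alpha_pos[OF k]] by (intro nn_integral_mono) (simp add: T_def X_def)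
    also have "\<dots> = E k + (\<integral>\<^sup>+\<omega>. ennreal ((\<alpha> k)\<^sup>2 * (C * (1 + d (w k \<omega>) ^ 3))) \<partial>M)"
      unfolding E_def d_def by (rule nn_integral_add) measurable
    also have "(\<integral>\<^sup>+\<omega>. ennreal ((\<alpha> k)\<^sup>2 * (C * (1 + d (w k \<omega>) ^ 3))) \<partial>M)
        = ennreal (\<integral>\<omega>. (\<alpha> k)\<^sup>2 * (C * (1 + d (w k \<omega>) ^ 3)) \<partial>M)"
      using B(2)[OF k] C by (intro nn_integral_eq_integral) (auto simp: d_def)
    also have "(\<integral>\<omega>. (\<alpha> k)\<^sup>2 * (C * (1 + d (w k \<omega>) ^ 3)) \<partial>M)
        = (\<alpha> k)\<^sup>2 * (C * (1 + (\<integral>\<omega>. d (w k \<omega>) ^ 3 \<partial>M)))"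
      using B(2)[OF k] by (simp add: prob_space)
    \<comment> \<open>The third moment bound makes the factor of the squared step size independent
      of \<open>k\<close>.\<close>
    also have "ennreal \<dots> \<le> ennreal ((\<alpha> k)\<^sup>2 * (C * (1 + B)))"
      using B(3)[OF k] C by (intro ennreal_leI mult_left_mono add_left_mono) auto
    finally show ?thesis by (simp add: add_left_mono)
  qed

  define K where "K = (\<Sum>k. (\<alpha> (k + 1))\<^sup>2) * (C * (1 + B))"
  \<comment> \<open>Telescoping in additive form: \<open>E (Suc n)\<close> stays on the left and is
    dropped afterwards as nonnegative. The shift by \<open>Suc\<close> makes \<open>k<n\<close> run
    through the steps 1 to \<open>n\<close>.\<close>
  have g_sum: "E (Suc n) + (\<Sum>k<n. g (Suc k)) \<le> E 1 + ennreal ((\<Sum>k<n. (\<alpha> (Suc k))\<^sup>2) * (C * (1 + B)))" for n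
  proof (induction n)
    case (Suc n)
    let ?a = "\<lambda>n. (\<Sum>k<n. (\<alpha> (Suc k))\<^sup>2) * (C * (1 + B))"
    have "E (Suc (Suc n)) + (\<Sum>k<Suc n. g (Suc k)) = (E (Suc (Suc n)) + g (Suc n)) + (\<Sum>k<n. g (Suc k))"
      by (simp add: ac_simps)
    also have "\<dots> \<le> (E (Suc n) + ennreal ((\<alpha> (Suc n))\<^sup>2 * (C * (1 + B)))) + (\<Sum>k<n. g (Suc k))"
      by (intro add_right_mono E_step) simp
    also have "\<dots> \<le> (E 1 + ennreal (?a n)) + ennreal ((\<alpha> (Suc n))\<^sup>2 * (C * (1 + B)))"
      using add_right_mono[OF Suc, of "ennreal ((\<alpha> (Suc n))\<^sup>2 * (C * (1 + B)))"] by (simp add: ac_simps)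
    also have "\<dots> = E 1 + ennreal (?a (Suc n))"
      using C B(1) by (simp add: ennreal_plus[symmetric] sum_nonneg algebra_simps del: ennreal_plus)
    finally show ?case .
  qed simp
  have g_le: "(\<Sum>k<n. g (Suc k)) \<le> E 1 + ennreal K" for n
  proof -
    have "(\<Sum>k<n. (\<alpha> (Suc k))\<^sup>2) \<le> (\<Sum>k. (\<alpha> (k + 1))\<^sup>2)"
      using sum_le_suminf[OF alpha_sq_summable, of "{..<n}"] by simp
    then have "(\<Sum>k<n. (\<alpha> (Suc k))\<^sup>2) * (C * (1 + B)) \<le> K"
      unfolding K_def using C B(1) by (intro mult_right_mono) auto
    then have "E 1 + ennreal ((\<Sum>k<n. (\<alpha> (Suc k))\<^sup>2) * (C * (1 + B))) \<le> E 1 + ennreal K"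
      by (intro add_left_mono ennreal_leI)
    moreover have "(\<Sum>k<n. g (Suc k)) \<le> E (Suc n) + (\<Sum>k<n. g (Suc k))"
      by (rule add_increasing) auto
    ultimately show ?thesis
      using g_sum[of n] by (blast intro: order_trans)
  qed
  \<comment> \<open>The deterministic start makes the initial gap finite, which bounds the whole
    series.\<close>
  have E_1: "E 1 = ennreal (F w1 - m)"
    unfolding E_def using w_init by (simp add: emeasure_space_1 cong: nn_integral_cong)

  \<comment> \<open>Sum and integral commute for nonnegative terms, so \<open>Z\<close> has finite
    expectation and is finite almost surely.\<close>
  define Z where "Z \<omega> = (\<Sum>k. ennreal (\<alpha> (Suc k) * (norm (gradient F (w (Suc k) \<omega>)))\<^sup>2))" for \<omega>
  have w_Suc [measurable]: "w (Suc k) \<in> borel_measurable M" for k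
    by (rule w_measurable) simp
  have "(\<integral>\<^sup>+\<omega>. Z \<omega> \<partial>M) = (\<Sum>k. g (Suc k))"
    unfolding Z_def g_def by (rule nn_integral_suminf) measurable
  also have "\<dots> \<le> E 1 + ennreal K"
    using g_le by (intro suminf_le_const summableI)
  also have "\<dots> < \<infinity>"
    unfolding E_1 by simp
  finally have "AE \<omega> in M. Z \<omega> \<noteq> \<infinity>"
    by (intro nn_integral_PInf_AE) (auto simp: Z_def[abs_def])
  then have "AE \<omega> in M. (\<lambda>K. min_sq_grad F w K \<omega>) \<longlonglongrightarrow> 0"
  proof eventually_elim
    case (elim \<omega>)
    show ?case
      unfolding min_sq_grad_def
    proof (rule Min_weighted_sum_tendsto_0[OF alpha_pos _ _ alpha_diverges])
      fix n
      let ?y = "\<lambda>k. \<alpha> k * (norm (gradient F (w k \<omega>)))\<^sup>2"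
      have nonneg: "0 \<le> ?y (Suc k)" for k
        using alpha_pos[of "Suc k"] by simp
      have "ennreal (\<Sum>k=1..n. ?y k) = (\<Sum>k<n. ennreal (?y (Suc k)))"
        using nonneg by (simp add: sum.atLeast1_atMost_eq sum_ennreal)
      also have "\<dots> \<le> Z \<omega>"
        unfolding Z_def by (intro sum_le_suminf summableI) auto
      \<comment> \<open>The bound for the weighted sums depends on the path but not on
        \<open>n\<close>; finiteness of \<open>Z \<omega>\<close> keeps \<open>enn2real\<close>
        monotone here.\<close>
      finally have "enn2real (ennreal (\<Sum>k=1..n. ?y k)) \<le> enn2real (Z \<omega>)"
        using elim by (intro enn2real_mono) (auto simp: top.not_eq_extremum)
      moreover have "0 \<le> (\<Sum>k=1..n. ?y k)"
        by (intro sum_nonneg mult_nonneg_nonneg) (auto intro: less_imp_le[OF alpha_pos])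
      ultimately show "(\<Sum>k=1..n. ?y k) \<le> enn2real (Z \<omega>)"
        by simp
    qed auto
  qed
  \<comment> \<open>Completeness enters here: the exceptional set lies in a null set and is
    therefore itself measurable and null.\<close>
  then have null: "{\<omega> \<in> space M. \<not> (\<lambda>K. min_sq_grad F w K \<omega>) \<longlonglongrightarrow> 0} \<in> null_sets M"
    by (simp add: AE_iff_null_sets)
  have "{\<omega> \<in> space M. (\<lambda>K. min_sq_grad F w K \<omega>) \<longlonglongrightarrow> 0}
      = space M - {\<omega> \<in> space M. \<not> (\<lambda>K. min_sq_grad F w K \<omega>) \<longlonglongrightarrow> 0}"
    by auto
  with null show ?thesis
    using prob_compl[of "{\<omega> \<in> space M. \<not> (\<lambda>K. min_sq_grad F w K \<omega>) \<longlonglongrightarrow> 0}"]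
    by (simp add: null_sets_def measure_def)
qed

end
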